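(* The decoupling algorithm is asymptotically $3$-approximate for the container delivery scheduling problem.
   Context: An instance $\langle \mathcal{I},B\rangle$ of the container delivery scheduling problem consists of a set $\mathcal{I}=\{1,\ldots,n\}$ of items, each item $i$ having a due time $d_i\in\mathbb{Z}^+$, and an inventory bound $B>0$. For a time $\tau\ge 0$ put $\delta_i(\tau)=|d_i-\tau|$. A feasible solution with $m$ bins is a partition of $\mathcal{I}$ into subsets (bins) $\mathcal{S}_1,\ldots,\mathcal{S}_m$ together with delivery times $\mu_1,\ldots,\mu_m\ge 0$ such that $\sum_{i\in\mathcal{S}_j}\delta_i(\mu_j)\le B$ for every $j$. Several bins may be delivered at the same time. An optimal solution is a feasible solution minimizing the number of bins; this minimum is denoted $\hat m$. An algorithm is asymptotically $\rho$-approximate if there is a constant $c$, independent of the instance, such that on every instance it returns a feasible solution with $m\le\rho\,\hat m+c$ bins. For a finite set $\mathcal{V}$ of times, $\delta_i(\mathcal{V})=\min_{\tau\in\mathcal{V}}|d_i-\tau|$. The subproblem $\mathrm{ET}(\mathcal{I},B,k)$ asks for a set $\mathcal{V}$ of $k$ times that minimizes $\sum_{i\in\mathcal{I}}\delta_i(\mathcal{V})$ subject to $\delta_i(\mathcal{V})\le B$ for every $i\in\mathcal{I}$. Decoupling algorithm: for each $k\in\{1,\ldots,n\}$ for which $\mathrm{ET}(\mathcal{I},B,k)$ is feasible, compute an optimal solution $\mathcal{V}^{(k)}=\{\tau_1<\ldots<\tau_k\}$ of $\mathrm{ET}(\mathcal{I},B,k)$; assign every item $i$ to one time of $\mathcal{V}^{(k)}$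 closest to $d_i$ (ties broken arbitrarily), and let $\mathcal{D}_t^{(k)}$ be the set of items assigned to $\tau_t$; for each $t$, use a standard bin packing algorithm (First-Fit or First-Fit Decreasing) to pack the items of $\mathcal{D}_t^{(k)}$ into bins of capacity $B$, where item $i$ has size $\delta_i(\mathcal{V}^{(k)})$, and deliver all these bins at time $\tau_t$. Let $\mathcal{S}^{(k)}$ be the resulting solution. Return a solution $\mathcal{S}^{(k)}$ with the fewest bins over all such $k$. *)

theory Defs
  imports Complex_Main "HOL-Library.Disjoint_Sets"
begin

record instance_cds =
  num_items :: nat
  due :: "nat \<Rightarrow> nat"
  bound :: real

definition items :: "instance_cds \<Rightarrow> nat set" where
  "items I = {1..num_items I}"

text \<open>Only the values of \<^term>\<open>due I\<close> on \<^term>\<open>items I\<close> are relevant.\<close>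

definition valid_instance :: "instance_cds \<Rightarrow> bool" where
  "valid_instance I \<longleftrightarrow> num_items I \<ge> 1 \<and> (\<forall>i\<in>items I. due I i > 0) \<and> bound I > 0"

definition \<delta> :: "instance_cds \<Rightarrow> nat \<Rightarrow> real \<Rightarrow> real" where
  "\<delta> I i \<tau> = \<bar>real (due I i) - \<tau>\<bar>"

text \<open>A solution lists its bins, each with its delivery time, so that the number of bins is the
  length of the list and several bins may share a delivery time.\<close>

type_synonym solution = "(nat set \<times> real) list"

definition feasible :: "instance_cds \<Rightarrow> solution \<Rightarrow> bool" where
  "feasible I S \<longleftrightarrow>
     partition_on (items I) (set (map fst S)) \<and> distinct (map fst S) \<and>
     (\<forall>(A, \<mu>)\<in>set S. \<mu> \<ge> 0 \<and> (\<Sum>i\<in>A. \<delta> I i \<mu>) \<le> bound I)"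

definition opt_bins :: "instance_cds \<Rightarrow> nat" where
  "opt_bins I = (LEAST m. \<exists>S. feasible I S \<and> length S = m)"

text \<open>The choices an algorithm leaves open (ties, processing orders, which optimal solution of a
  subproblem is found) are modelled by mapping an instance to the set of all possible outputs.
  Nonemptiness of this set says that the algorithm does return a solution.\<close>

definition asymptotically_approximate :: "real \<Rightarrow> (instance_cds \<Rightarrow> solution set) \<Rightarrow> bool" where
  "asymptotically_approximate \<rho> alg \<longleftrightarrow>
     (\<exists>c::real. \<forall>I. valid_instance I \<longrightarrow>
        alg I \<noteq> {} \<and>
        (\<forall>S\<in>alg I. feasible I S \<and> real (length S) \<le> \<rho> * real (opt_bins I) + c))"

definition \<delta>_set :: "instance_cds \<Rightarrow> nat \<Rightarrow> real set \<Rightarrow> real" where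
  "\<delta>_set I i V = Min ((\<lambda>\<tau>. \<delta> I i \<tau>) ` V)"

definition ET_feasible :: "instance_cds \<Rightarrow> nat \<Rightarrow> real set \<Rightarrow> bool" where
  "ET_feasible I k V \<longleftrightarrow>
     finite V \<and> card V = k \<and> (\<forall>\<tau>\<in>V. \<tau> \<ge> 0) \<and> (\<forall>i\<in>items I. \<delta>_set I i V \<le> bound I)"

definition ET_optimal :: "instance_cds \<Rightarrow> nat \<Rightarrow> real set \<Rightarrow> bool" where
  "ET_optimal I k V \<longleftrightarrow> is_arg_min (\<lambda>V. \<Sum>i\<in>items I. \<delta>_set I i V) (ET_feasible I k) V"

definition feasible_ks :: "instance_cds \<Rightarrow> nat set" where
  "feasible_ks I = {k \<in> {1..num_items I}. \<exists>V. ET_feasible I k V}"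

fun ff_insert :: "('a \<Rightarrow> real) \<Rightarrow> real \<Rightarrow> 'a \<Rightarrow> 'a set list \<Rightarrow> 'a set list" where
  "ff_insert s C x [] = [{x}]"
| "ff_insert s C x (b # bs) =
     (if sum s b + s x \<le> C then insert x b # bs else b # ff_insert s C x bs)"

definition first_fit :: "('a \<Rightarrow> real) \<Rightarrow> real \<Rightarrow> 'a list \<Rightarrow> 'a set list" where
  "first_fit s C xs = fold (ff_insert s C) xs []"

datatype packing_rule = First_Fit | First_Fit_Decreasing

text \<open>Both rules run \<^const>\<open>first_fit\<close>; they differ in the orders in which the items may arrive.\<close>

fun packing_order :: "packing_rule \<Rightarrow> ('a \<Rightarrow> real) \<Rightarrow> 'a set \<Rightarrow> 'a list \<Rightarrow> bool" where
  "packing_order First_Fit s D xs \<longleftrightarrow> distinct xs \<and> set xs = D"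
| "packing_order First_Fit_Decreasing s D xs \<longleftrightarrow>
     distinct xs \<and> set xs = D \<and> sorted_wrt (\<lambda>x y. s x \<ge> s y) xs"

definition bin_packings ::
  "packing_rule \<Rightarrow> ('a \<Rightarrow> real) \<Rightarrow> real \<Rightarrow> 'a set \<Rightarrow> 'a set list set" where
  "bin_packings r s C D = {first_fit s C xs | xs. packing_order r s D xs}"

definition closest_assignment :: "instance_cds \<Rightarrow> real set \<Rightarrow> (nat \<Rightarrow> real) \<Rightarrow> bool" where
  "closest_assignment I V \<sigma> \<longleftrightarrow>
     (\<forall>i\<in>items I. is_arg_min (\<delta> I i) (\<lambda>\<tau>. \<tau> \<in> V) (\<sigma> i))"

text \<open>All solutions that the iteration for \<^term>\<open>k\<close> may produce: \<^term>\<open>P \<tau>\<close> is the packing of the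
  items that \<^term>\<open>\<sigma>\<close> assigns to \<^term>\<open>\<tau>\<close>. Times without items contribute no bins.\<close>

definition decoupling_step :: "packing_rule \<Rightarrow> instance_cds \<Rightarrow> nat \<Rightarrow> solution set" where
  "decoupling_step r I k =
     {concat (map (\<lambda>\<tau>. map (\<lambda>A. (A, \<tau>)) (P \<tau>)) (sorted_list_of_set V)) | V \<sigma> P.
        ET_optimal I k V \<and> closest_assignment I V \<sigma> \<and>
        (\<forall>\<tau>\<in>V. P \<tau> \<in> bin_packings r (\<lambda>i. \<delta>_set I i V) (bound I) {i \<in> items I. \<sigma> i = \<tau>})}"

definition decoupling :: "packing_rule \<Rightarrow> instance_cds \<Rightarrow> solution set" where
  "decoupling r I =
     {S k | S k. (\<forall>k\<in>feasible_ks I. S k \<in> decoupling_step r I k) \<and>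
                 is_arg_min (\<lambda>k. length (S k)) (\<lambda>k. k \<in> feasible_ks I) k}"

end

theory Submission
  imports Defs
begin

text \<open>Let an optimal solution use \<open>m\<close> bins and \<open>k\<close> distinct delivery times, so \<open>k \<le> m\<close>. Its times form
  a feasible point of the subproblem for \<open>k\<close> of cost at most \<open>m * B\<close>. In a First-Fit packing any two
  bins together exceed the capacity, so packing the items of one time uses at most one bin more than
  twice their total size divided by \<open>B\<close>. Summed over the \<open>k\<close> times this gives at most
  \<open>2 * m + k \<le> 3 * m\<close> bins. The subproblems have optimal solutions because the optimal time of each
  of the finitely many possible clusters exists by compactness.\<close>

section \<open>First-Fit\<close>

lemma Union_ff_insert: "\<Union> (set (ff_insert s C x bs)) = insert x (\<Union> (set bs))"
  by (induction bs) auto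

lemma empty_notin_ff_insert: "{} \<notin> set bs \<Longrightarrow> {} \<notin> set (ff_insert s C x bs)"
  by (induction bs) auto

text \<open>Disjointness is kept along the list rather than for the set of bins: with nonempty bins
  it then also excludes that a bin is listed twice.\<close>

lemma disjnt_ff_insert:
  assumes "sorted_wrt disjnt bs" "x \<notin> \<Union> (set bs)"
  shows "sorted_wrt disjnt (ff_insert s C x bs)"
  using assms
proof (induction bs)
  case (Cons b bs)
  have "disjnt b c" if "c \<in> set (ff_insert s C x bs)" for c
  proof -
    have "b \<inter> (insert x (\<Union> (set bs))) = {}"
      using Cons.prems by (auto simp: disjnt_def)
    then show ?thesis
      using that Union_ff_insert[of s C x bs] unfolding disjnt_def by blast
  qed
  then show ?case
    using Cons by (auto simp: disjnt_def)
qed simp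

lemma ff_insert_capacity:
  assumes "\<forall>b\<in>set bs. finite b \<and> sum s b \<le> C" "s x \<le> C" "x \<notin> \<Union> (set bs)"
  shows "\<forall>b\<in>set (ff_insert s C x bs). finite b \<and> sum s b \<le> C"
  using assms by (induction bs) (auto simp: add.commute)

text \<open>After the insertion a bin is old, old and enlarged by \<open>x\<close>, or equal to
  \<open>{x}\<close>; as \<open>s x\<close> \<ge> 0, enlarging lowers no load.\<close>

lemma ff_insert_new_load:
  assumes "\<forall>b\<in>set bs. finite b" "s x \<ge> 0" "x \<notin> \<Union> (set bs)" "c \<in> set (ff_insert s C x bs)"
  shows "\<exists>b \<in> insert {x} (set bs). sum s b \<le> sum s c"
  using assms by (induction bs) (auto split: if_splits)

text \<open>A bin is opened only when its first item fits in no earlier bin, and loads never decrease.\<close>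

lemma ff_insert_pair_load:
  assumes "\<forall>b\<in>set bs. finite b" "s x \<ge> 0" "x \<notin> \<Union> (set bs)"
    "sorted_wrt (\<lambda>a b. sum s a + sum s b > C) bs"
  shows "sorted_wrt (\<lambda>a b. sum s a + sum s b > C) (ff_insert s C x bs)"
  using assms
proof (induction bs)
  case (Cons b bs)
  show ?case
  proof (cases "sum s b + s x \<le> C")
    case True
    then show ?thesis using Cons.prems by fastforce
  next
    case False
    \<comment> \<open>A bin behind \<open>b\<close> weighs at least as much as \<open>{x}\<close>,
      which did not fit into \<open>b\<close>, or as some bin of the old tail, which already
      exceeded \<open>C\<close> together with \<open>b\<close>.\<close>
    have "sum s b + sum s c > C" if "c \<in> set (ff_insert s C x bs)" for c
    proof -
      have "\<exists>a\<in>insert {x} (set bs). sum s a \<le> sum s c"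
        using Cons.prems that by (intro ff_insert_new_load[of bs s x c C]) auto
      then obtain a where "a \<in> insert {x} (set bs)" "sum s a \<le> sum s c" by blast
      then show ?thesis using False Cons.prems by fastforce
    qed
    then show ?thesis using False Cons by auto
  qed
qed simp

text \<open>The invariants are proved together because an insertion needs that \<open>x\<close> lies
  in no present bin, which the union and \<open>distinct\<close> supply. The induction peels off the
  last item since \<open>fold\<close> inserts it last.\<close>

lemma first_fit_properties:
  assumes "distinct xs" "\<forall>x\<in>set xs. 0 \<le> s x \<and> s x \<le> C"
  shows "\<Union> (set (first_fit s C xs)) = set xs \<and> {} \<notin> set (first_fit s C xs) \<and>
    sorted_wrt disjnt (first_fit s C xs) \<and>
    (\<forall>b\<in>set (first_fit s C xs). finite b \<and> sum s b \<le> C) \<and>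
    sorted_wrt (\<lambda>a b. sum s a + sum s b > C) (first_fit s C xs)"
  using assms
proof (induction xs rule: rev_induct)
  case Nil
  then show ?case by (simp add: first_fit_def)
next
  case (snoc x xs)
  let ?bs = "first_fit s C xs"
  have eq: "first_fit s C (xs @ [x]) = ff_insert s C x ?bs"
    by (simp add: first_fit_def)
  have IH: "\<Union> (set ?bs) = set xs" "{} \<notin> set ?bs" "sorted_wrt disjnt ?bs"
    "\<forall>b\<in>set ?bs. finite b \<and> sum s b \<le> C" "sorted_wrt (\<lambda>a b. sum s a + sum s b > C) ?bs"
    using snoc by auto
  have x: "x \<notin> \<Union> (set ?bs)" "0 \<le> s x" "s x \<le> C" using snoc.prems IH(1) by auto
  have fin: "\<forall>b\<in>set ?bs. finite b" using IH(4) by blast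
  show ?case
    unfolding eq
  proof (intro conjI)
    show "\<Union> (set (ff_insert s C x ?bs)) = set (xs @ [x])"
      unfolding Union_ff_insert IH(1) by simp
  qed (rule empty_notin_ff_insert[OF IH(2)] disjnt_ff_insert[OF IH(3) x(1)]
      ff_insert_capacity[OF IH(4) x(3,1)] ff_insert_pair_load[OF fin x(2,1) IH(5)])+
qed

text \<open>Consecutive bins are taken in pairs: two bins cost \<open>2 * C\<close> and have joint
  load above \<open>C\<close>. A bin left over at the end is paid by the additional
  \<open>C\<close>.\<close>

lemma pair_load_length:
  assumes "sorted_wrt (\<lambda>a b. f a + f b > (C::real)) bs" "\<forall>b\<in>set bs. f b \<ge> 0" "C \<ge> 0"
  shows "real (length bs) * C \<le> 2 * (\<Sum>b\<leftarrow>bs. f b) + C"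
  using assms by (induction bs rule: induct_list012) (auto simp: algebra_simps)

text \<open>A bin listed twice would be disjoint from itself, hence empty.\<close>

lemma disjnt_distinct:
  assumes "sorted_wrt disjnt bs" "{} \<notin> set bs"
  shows "distinct bs"
  using assms by (induction bs) (auto simp: disjnt_def)

lemma disjnt_partition_on:
  assumes "sorted_wrt disjnt bs" "{} \<notin> set bs"
  shows "partition_on (\<Union> (set bs)) (set bs)"
proof (rule partition_onI)
  \<comment> \<open>\<open>sorted_wrt\<close> compares only in list order; symmetry of
    \<open>disjnt\<close> removes the order.\<close>
  have "\<forall>p\<in>set bs. \<forall>q\<in>set bs. p \<noteq> q \<longrightarrow> disjnt p q"
    using assms(1) by (induction bs) (auto simp: disjnt_sym)
  then show "disjnt p q" if "p \<in> set bs" "q \<in> set bs" "p \<noteq> q" for p q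
    using that by blast
qed (use assms in auto)

lemma sum_list_partition:
  assumes "partition_on A (set bs)" "distinct bs" "finite A"
  shows "(\<Sum>b\<leftarrow>bs. sum s b) = sum s A"
proof -
  have "(\<Sum>b\<leftarrow>bs. sum s b) = (\<Sum>b\<in>set bs. sum s b)"
    using assms by (simp add: sum_list_distinct_conv_sum_set)
  also have "\<dots> = sum s (\<Union> (set bs))"
    using assms finite_elements[OF assms(3,1)]
    by (subst sum.Union_disjoint)
      (auto simp: partition_on_def disjoint_def intro: finite_subset)
  finally show ?thesis using assms by (simp add: partition_on_def)
qed

text \<open>Either rule is First-Fit on some enumeration of \<open>D\<close>, and the invariants
  hold for every enumeration. The bin count is bounded in the form multiplied by \<open>C\<close>,
  which avoids division.\<close>

lemma bin_packings_properties:
  assumes "bs \<in> bin_packings r s C D" "\<forall>x\<in>D. 0 \<le> s x \<and> s x \<le> C" "C \<ge> 0"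
  shows "\<Union> (set bs) = D" "{} \<notin> set bs" "sorted_wrt disjnt bs" "\<forall>b\<in>set bs. sum s b \<le> C"
    "real (length bs) * C \<le> 2 * sum s D + C"
proof -
  obtain xs where xs: "bs = first_fit s C xs" "distinct xs" "set xs = D"
    using assms(1) unfolding bin_packings_def by (cases r) auto
  note ff = first_fit_properties[of xs s C, unfolded xs(1)[symmetric]]
  show un: "\<Union> (set bs) = D" and ne: "{} \<notin> set bs" and dis: "sorted_wrt disjnt bs"
    and "\<forall>b\<in>set bs. sum s b \<le> C"
    using ff xs assms by auto
  have "\<forall>b\<in>set bs. sum s b \<ge> 0"
    using un assms(2) by (auto intro!: sum_nonneg)
  then have "real (length bs) * C \<le> 2 * (\<Sum>b\<leftarrow>bs. sum s b) + C"
    using ff xs assms by (intro pair_load_length) auto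
  also have "(\<Sum>b\<leftarrow>bs. sum s b) = sum s D"
    using disjnt_partition_on[OF dis ne] disjnt_distinct[OF dis ne] finite_set[of xs]
    unfolding un xs(3) by (rule sum_list_partition)
  finally show "real (length bs) * C \<le> 2 * sum s D + C" .
qed

text \<open>A decreasing order serves both rules; it arises by sorting with negated sizes as keys,
  as \<open>sort_key\<close> sorts upwards.\<close>

lemma bin_packings_nonempty:
  assumes "finite D"
  shows "bin_packings r s C D \<noteq> {}"
proof -
  obtain ys where ys: "distinct ys" "set ys = D"
    using finite_distinct_list[OF assms] by blast
  have "sorted (map (\<lambda>x. - s x) (sort_key (\<lambda>x. - s x) ys))" by simp
  then have "packing_order r s D (sort_key (\<lambda>x. - s x) ys)"
    using ys by (cases r) (auto simp: sorted_map)
  then show ?thesis unfolding bin_packings_def by blast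
qed

section \<open>The subproblem ET\<close>

lemma finite_items [simp]: "finite (items I)"
  by (simp add: items_def)

lemma \<delta>_nonneg [simp]: "\<delta> I i \<tau> \<ge> 0"
  by (simp add: \<delta>_def)

lemma \<delta>_set_le:
  assumes "finite V" "\<tau> \<in> V"
  shows "\<delta>_set I i V \<le> \<delta> I i \<tau>"
  using assms by (simp add: \<delta>_set_def)

lemma \<delta>_set_argmin:
  assumes "finite V" "is_arg_min (\<delta> I i) (\<lambda>\<tau>. \<tau> \<in> V) \<tau>"
  shows "\<delta>_set I i V = \<delta> I i \<tau>"
proof -
  have "\<tau> \<in> V" "\<forall>t\<in>V. \<delta> I i \<tau> \<le> \<delta> I i t"
    using assms(2) by (auto simp: is_arg_min_def not_less)
  then show ?thesis
    using assms(1) unfolding \<delta>_set_def by (intro Min_eqI) auto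
qed

text \<open>Extreme value theorem: the admissible times form a compact set, nonempty because of
  \<open>\<tau>\<^sub>0\<close>, and the cost is continuous.\<close>

lemma cluster_time_exists:
  assumes "finite A" "A \<noteq> {}" "\<tau>\<^sub>0 \<ge> 0" "\<forall>i\<in>A. \<delta> I i \<tau>\<^sub>0 \<le> bound I"
  shows "\<exists>\<tau>. is_arg_min (\<lambda>\<tau>. \<Sum>i\<in>A. \<delta> I i \<tau>) (\<lambda>\<tau>. \<tau> \<ge> 0 \<and> (\<forall>i\<in>A. \<delta> I i \<tau> \<le> bound I)) \<tau>"
proof -
  define K where "K = {0..} \<inter> (\<Inter>i\<in>A. {real (due I i) - bound I .. real (due I i) + bound I})"
  have mem_K: "\<tau> \<in> K \<longleftrightarrow> \<tau> \<ge> 0 \<and> (\<forall>i\<in>A. \<delta> I i \<tau> \<le> bound I)" for \<tau>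
    by (auto simp: K_def \<delta>_def abs_le_iff algebra_simps)
  obtain a where a: "a \<in> A" using assms(2) by blast
  \<comment> \<open>An item of the nonempty cluster confines \<open>K\<close> to a bounded interval;
    intersecting with it once more writes \<open>K\<close> as a compact set met with a closed
    one.\<close>
  have "compact ({real (due I a) - bound I .. real (due I a) + bound I} \<inter> K)"
    unfolding K_def
    by (intro compact_Int_closed compact_Icc closed_Int closed_INT closed_atLeast ballI closed_atLeastAtMost)
  moreover have "{real (due I a) - bound I .. real (due I a) + bound I} \<inter> K = K"
    using a unfolding K_def by blast
  ultimately have "compact K" by simp
  moreover have "K \<noteq> {}" using mem_K[of \<tau>\<^sub>0] assms by auto
  moreover have "continuous_on K (\<lambda>\<tau>. \<Sum>i\<in>A. \<delta> I i \<tau>)"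
    unfolding \<delta>_def by (intro continuous_intros)
  ultimately obtain \<tau> where \<tau>: "\<tau> \<in> K" "\<forall>t\<in>K. (\<Sum>i\<in>A. \<delta> I i \<tau>) \<le> (\<Sum>i\<in>A. \<delta> I i t)"
    using continuous_attains_inf[of K "\<lambda>\<tau>. \<Sum>i\<in>A. \<delta> I i \<tau>"] by blast
  have "is_arg_min (\<lambda>\<tau>. \<Sum>i\<in>A. \<delta> I i \<tau>) (\<lambda>\<tau>. \<tau> \<in> K) \<tau>"
    using \<tau> by (auto simp: is_arg_min_linorder)
  then show ?thesis
    unfolding mem_K by (rule exI)
qed

text \<open>The subproblem wants exactly \<open>k\<close> times, so a smaller set has to be filled
  up; the half-line leaves infinitely many points for this.\<close>

lemma extend_times:
  assumes "finite U" "U \<subseteq> {0::real..}" "card U \<le> k"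
  shows "\<exists>W. U \<subseteq> W \<and> finite W \<and> card W = k \<and> W \<subseteq> {0..}"
proof -
  have "infinite ({0::real..} - U)" using assms infinite_Ici by simp
  then obtain E where E: "finite E" "card E = k - card U" "E \<subseteq> {0..} - U"
    using infinite_arbitrarily_large by blast
  then have "card (U \<union> E) = k"
    using assms by (subst card_Un_disjoint) auto
  then show ?thesis using E assms by (intro exI[of _ "U \<union> E"]) auto
qed

lemma closest_assignment_exists:
  assumes "finite V" "V \<noteq> {}"
  shows "\<exists>\<sigma>. closest_assignment I V \<sigma>"
proof -
  have "\<forall>i. \<exists>\<tau>. is_arg_min (\<delta> I i) (\<lambda>\<tau>. \<tau> \<in> V) \<tau>"
    using ex_is_arg_min_if_finite[OF assms] by blast
  then show ?thesis unfolding closest_assignment_def by metis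
qed

text \<open>Moving every time to the optimal time of its cluster leaves only finitely many candidate sets;
  times lost on the way are refilled arbitrarily, which does not increase the cost.\<close>

lemma ET_optimal_exists:
  assumes "ET_feasible I k V\<^sub>0" "k \<ge> 1" "items I \<noteq> {}"
  shows "\<exists>V. ET_optimal I k V"
proof -
  define cost where "cost V = (\<Sum>i\<in>items I. \<delta>_set I i V)" for V
  define ok where "ok A \<tau> \<longleftrightarrow> \<tau> \<ge> 0 \<and> (\<forall>i\<in>A. \<delta> I i \<tau> \<le> bound I)" for A \<tau>
  \<comment> \<open>\<open>best\<close> and \<open>ext\<close> are fixed choices that depend on a
    cluster or a set of times alone, not on the solution to be improved; hence the candidates in
    \<open>F\<close> come from a finite power set.\<close>
  define best where "best A = (SOME \<tau>. is_arg_min (\<lambda>\<tau>. \<Sum>i\<in>A. \<delta> I i \<tau>) (ok A) \<tau>)" for A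
  define ext where "ext U = (SOME W. U \<subseteq> W \<and> finite W \<and> card W = k \<and> W \<subseteq> {0::real..})" for U
  define F where "F = {W \<in> ext ` Pow (best ` Pow (items I)). ET_feasible I k W}"
  have best: "ok A (best A)" "(\<Sum>i\<in>A. \<delta> I i (best A)) \<le> (\<Sum>i\<in>A. \<delta> I i \<tau>)"
    if "A \<noteq> {}" "A \<subseteq> items I" "ok A \<tau>" for A \<tau>
  proof -
    have "\<exists>\<tau>. is_arg_min (\<lambda>\<tau>. \<Sum>i\<in>A. \<delta> I i \<tau>) (ok A) \<tau>"
      using cluster_time_exists[of A \<tau> I] that finite_subset[OF that(2)] unfolding ok_def by auto
    then have "is_arg_min (\<lambda>\<tau>. \<Sum>i\<in>A. \<delta> I i \<tau>) (ok A) (best A)"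
      unfolding best_def by (rule someI_ex)
    then show "ok A (best A)" "(\<Sum>i\<in>A. \<delta> I i (best A)) \<le> (\<Sum>i\<in>A. \<delta> I i \<tau>)"
      using that(3) by (auto simp: is_arg_min_linorder)
  qed
  have dominated: "\<exists>W\<in>F. cost W \<le> cost V" if V: "ET_feasible I k V" for V
  proof -
    have fin: "finite V" "card V = k" "V \<noteq> {}" using V assms(2) by (auto simp: ET_feasible_def)
    obtain \<sigma> where \<sigma>: "closest_assignment I V \<sigma>"
      using closest_assignment_exists fin by blast
    define D where "D \<tau> = {i \<in> items I. \<sigma> i = \<tau>}" for \<tau>
    \<comment> \<open>Times without items are dropped, as \<open>best\<close> is controlled only on
      nonempty clusters.\<close>
    define T where "T = \<sigma> ` items I"
    define U where "U = (best \<circ> D) ` T"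
    have \<sigma>V: "\<sigma> i \<in> V" "\<delta>_set I i V = \<delta> I i (\<sigma> i)" if "i \<in> items I" for i
      using \<sigma> \<delta>_set_argmin[OF fin(1)] that
      by (auto simp: closest_assignment_def is_arg_min_def)
    have TV: "T \<subseteq> V" using \<sigma>V by (auto simp: T_def)
    have D: "D \<tau> \<noteq> {}" "D \<tau> \<subseteq> items I" "ok (D \<tau>) \<tau>" if "\<tau> \<in> T" for \<tau>
      using that V \<sigma>V by (force simp: D_def T_def ok_def ET_feasible_def)+
    have finT: "finite T" by (simp add: T_def)
    \<comment> \<open>Two clusters may share their best time, so \<open>U\<close> can be smaller
      than \<open>T\<close>; \<open>ext\<close> restores the count \<open>k\<close>.\<close>
    have "card U \<le> card T" unfolding U_def by (rule card_image_le[OF finT])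
    also have "\<dots> \<le> k" using card_mono[OF fin(1) TV] fin by simp
    finally have "card U \<le> k" .
    moreover have "finite U" "U \<subseteq> {0..}"
      using finT best(1)[OF D] by (auto simp: U_def ok_def)
    ultimately have W: "U \<subseteq> ext U" "finite (ext U)" "card (ext U) = k" "ext U \<subseteq> {0..}"
      using someI_ex[OF extend_times[of U k]] unfolding ext_def by auto
    have le: "\<delta>_set I i (ext U) \<le> \<delta> I i (best (D (\<sigma> i)))" if "i \<in> items I" for i
      using that W by (intro \<delta>_set_le) (auto simp: U_def T_def)
    have "\<delta>_set I i (ext U) \<le> bound I" if "i \<in> items I" for i
    proof -
      have "\<sigma> i \<in> T" "i \<in> D (\<sigma> i)" using that by (auto simp: T_def D_def)
      then have "\<delta> I i (best (D (\<sigma> i))) \<le> bound I"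
        using best(1)[OF D] by (auto simp: ok_def)
      then show ?thesis using le[OF that] by linarith
    qed
    then have "ET_feasible I k (ext U)" using W by (auto simp: ET_feasible_def)
    moreover have "U \<subseteq> best ` Pow (items I)"
      using D by (auto simp: U_def)
    ultimately have "ext U \<in> F" by (auto simp: F_def)
    moreover have "cost (ext U) \<le> cost V"
    proof -
      \<comment> \<open>The moved time of an item's cluster lies in \<open>ext U\<close> and bounds
        its new distance. The sum is then regrouped by assigned times, each cluster improves
        separately, and the regrouping is undone.\<close>
      have "cost (ext U) \<le> (\<Sum>i\<in>items I. \<delta> I i (best (D (\<sigma> i))))"
        unfolding cost_def by (intro sum_mono le)
      also have "\<dots> = (\<Sum>\<tau>\<in>T. \<Sum>i\<in>D \<tau>. \<delta> I i (best (D (\<sigma> i))))"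
        unfolding D_def by (rule sum.group[symmetric]) (auto simp: T_def)
      also have "\<dots> = (\<Sum>\<tau>\<in>T. \<Sum>i\<in>D \<tau>. \<delta> I i (best (D \<tau>)))"
        by (intro sum.cong) (auto simp: D_def)
      also have "\<dots> \<le> (\<Sum>\<tau>\<in>T. \<Sum>i\<in>D \<tau>. \<delta> I i \<tau>)"
        by (intro sum_mono best(2) D)
      also have "\<dots> = (\<Sum>\<tau>\<in>T. \<Sum>i\<in>D \<tau>. \<delta>_set I i V)"
        by (intro sum.cong) (auto simp: D_def \<sigma>V)
      also have "\<dots> = cost V"
        unfolding D_def cost_def by (rule sum.group) (auto simp: T_def)
      finally show ?thesis .
    qed
    ultimately show ?thesis by blast
  qed
  have "finite F" by (simp add: F_def)
  moreover have "F \<noteq> {}" using dominated[OF assms(1)] by blast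
  ultimately obtain W where W: "is_arg_min cost (\<lambda>W. W \<in> F) W"
    using ex_is_arg_min_if_finite by blast
  have "cost W \<le> cost V" if V: "ET_feasible I k V" for V
  proof -
    obtain X where "X \<in> F" "cost X \<le> cost V" using dominated[OF V] by blast
    moreover have "cost W \<le> cost X" using W \<open>X \<in> F\<close> by (auto simp: is_arg_min_linorder)
    ultimately show ?thesis by linarith
  qed
  then have "is_arg_min cost (ET_feasible I k) W"
    using W by (auto simp: is_arg_min_linorder F_def)
  then show ?thesis
    unfolding ET_optimal_def cost_def by blast
qed

section \<open>The decoupling algorithm\<close>

text \<open>Each item alone at its own due time has deviation 0. This makes the \<open>LEAST\<close>
  in \<open>opt_bins\<close> attained and bounds the optimum by the number of items, so that its
  number of delivery times lies in the range of \<open>k\<close>.\<close>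

lemma singleton_solution:
  assumes "valid_instance I"
  shows "\<exists>S. feasible I S \<and> length S = num_items I"
proof -
  let ?S = "map (\<lambda>i. ({i}, real (due I i))) [1..<Suc (num_items I)]"
  have fst_S: "map fst ?S = map (\<lambda>i. {i}) [1..<Suc (num_items I)]"
    by (simp add: comp_def)
  have "distinct (map fst ?S)"
    unfolding fst_S distinct_map by (simp add: inj_on_def)
  moreover have "partition_on (items I) (set (map fst ?S))"
    unfolding fst_S by (auto simp: partition_on_def items_def disjoint_def)
  ultimately have "feasible I ?S"
    using assms unfolding feasible_def by (simp del: upt_Suc) (auto simp: valid_instance_def \<delta>_def)
  then show ?thesis by (intro exI[of _ ?S]) simp
qed

lemma optimal_solution:
  assumes "valid_instance I"
  obtains S where "feasible I S" "length S = opt_bins I" "opt_bins I \<le> num_items I"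
proof -
  have "\<exists>m S. feasible I S \<and> length S = m" using singleton_solution[OF assms] by blast
  then have "\<exists>S. feasible I S \<and> length S = opt_bins I"
    unfolding opt_bins_def by (rule LeastI_ex)
  moreover have "opt_bins I \<le> num_items I"
    unfolding opt_bins_def using singleton_solution[OF assms] by (rule Least_le)
  ultimately show ?thesis using that by blast
qed

lemma items_nonempty: "valid_instance I \<Longrightarrow> items I \<noteq> {}"
  by (auto simp: valid_instance_def items_def)

text \<open>A single deviation is at most the deviation sum of its bin, hence at most
  \<open>bound I\<close>. Each bin adds at most \<open>bound I\<close> to the cost, since a closest
  time is no worse than the delivery time.\<close>

lemma feasible_ET:
  assumes "valid_instance I" "feasible I S"
  defines "V \<equiv> snd ` set S"
  shows "ET_feasible I (card V) V" "1 \<le> card V" "card V \<le> length S"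
    "(\<Sum>i\<in>items I. \<delta>_set I i V) \<le> real (length S) * bound I"
proof -
  have part: "partition_on (items I) (set (map fst S))" and dist: "distinct (map fst S)"
    and bnd: "\<And>A \<mu>. (A, \<mu>) \<in> set S \<Longrightarrow> \<mu> \<ge> 0 \<and> (\<Sum>i\<in>A. \<delta> I i \<mu>) \<le> bound I"
    using assms by (auto simp: feasible_def)
  have finV: "finite V" by (simp add: V_def)
  have bins: "A \<subseteq> items I" if "(A, \<mu>) \<in> set S" for A \<mu>
    using part that by (force simp: partition_on_def)
  have cover: "\<exists>A \<mu>. (A, \<mu>) \<in> set S \<and> i \<in> A" if "i \<in> items I" for i
    using part that by (force simp: partition_on_def)
  have "\<delta>_set I i V \<le> bound I" if i: "i \<in> items I" for i
  proof -
    obtain A \<mu> where A: "(A, \<mu>) \<in> set S" "i \<in> A" using cover[OF i] by blast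
    then have "\<delta>_set I i V \<le> \<delta> I i \<mu>" using finV by (intro \<delta>_set_le) (force simp: V_def)+
    also have "\<dots> \<le> (\<Sum>i\<in>A. \<delta> I i \<mu>)"
      using A bins[OF A(1)] by (intro member_le_sum) (auto intro: finite_subset)
    also have "\<dots> \<le> bound I" using bnd A by blast
    finally show ?thesis .
  qed
  then show "ET_feasible I (card V) V"
    using finV bnd by (auto simp: ET_feasible_def V_def)
  have "S \<noteq> []" using cover items_nonempty[OF assms(1)] by force
  then show "1 \<le> card V" by (simp add: V_def Suc_le_eq card_gt_0_iff)
  show "card V \<le> length S"
    unfolding V_def using card_image_le[of "set S" snd] card_length[of S] by simp
  have "(\<Sum>i\<in>items I. \<delta>_set I i V) = (\<Sum>A\<leftarrow>map fst S. \<Sum>i\<in>A. \<delta>_set I i V)"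
    using sum_list_partition[OF part dist finite_items] by (rule sym)
  also have "\<dots> = (\<Sum>b\<leftarrow>S. \<Sum>i\<in>fst b. \<delta>_set I i V)" by (simp add: comp_def)
  also have "\<dots> \<le> (\<Sum>b\<leftarrow>S. bound I)"
  proof (rule sum_list_mono)
    fix b assume "b \<in> set S"
    then have "(fst b, snd b) \<in> set S" by simp
    then have "(\<Sum>i\<in>fst b. \<delta> I i (snd b)) \<le> bound I" using bnd by blast
    moreover have "(\<Sum>i\<in>fst b. \<delta>_set I i V) \<le> (\<Sum>i\<in>fst b. \<delta> I i (snd b))"
      using \<open>b \<in> set S\<close> finV by (intro sum_mono \<delta>_set_le) (auto simp: V_def)
    ultimately show "(\<Sum>i\<in>fst b. \<delta>_set I i V) \<le> bound I" by linarith
  qed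
  also have "\<dots> = real (length S) * bound I" by (simp add: sum_list_triv)
  finally show "(\<Sum>i\<in>items I. \<delta>_set I i V) \<le> real (length S) * bound I" .
qed

text \<open>Bins of one time are disjoint by the packing, those of different times because they lie
  in different clusters \<open>D t\<close>; \<open>distinct ts\<close> keeps a time from being met
  twice.\<close>

lemma disjnt_concat:
  assumes "distinct ts" "\<forall>t\<in>set ts. sorted_wrt disjnt (P t) \<and> \<Union> (set (P t)) \<subseteq> D t"
    "\<And>t u. t \<noteq> u \<Longrightarrow> D t \<inter> D u = {}"
  shows "sorted_wrt disjnt (concat (map P ts))"
  using assms(1,2)
proof (induction ts)
  case (Cons t ts)
  have "disjnt a b" if "a \<in> set (P t)" "u \<in> set ts" "b \<in> set (P u)" for a b u
  proof -
    have "a \<subseteq> \<Union> (set (P t))" "b \<subseteq> \<Union> (set (P u))" "t \<noteq> u" using Cons.prems that by auto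
    moreover have "\<Union> (set (P t)) \<subseteq> D t" "\<Union> (set (P u)) \<subseteq> D u" using Cons.prems that by simp_all
    ultimately have "a \<subseteq> D t" "b \<subseteq> D u" "t \<noteq> u" by simp_all
    then show ?thesis using assms(3)[of t u] by (auto simp: disjnt_def)
  qed
  then show ?case using Cons by (auto simp: sorted_wrt_append)
qed simp

text \<open>An optimal set of times, a closest assignment and a packing at each time all exist, so
  every admissible iteration has an output.\<close>

lemma decoupling_step_nonempty:
  assumes "valid_instance I" "k \<in> feasible_ks I"
  shows "decoupling_step r I k \<noteq> {}"
proof -
  have k: "k \<ge> 1" using assms(2) by (simp add: feasible_ks_def)
  obtain V where V: "ET_optimal I k V"
    using ET_optimal_exists items_nonempty assms unfolding feasible_ks_def by force
  then have "finite V" "card V = k"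
    by (auto simp: ET_optimal_def is_arg_min_def ET_feasible_def)
  then obtain \<sigma> where \<sigma>: "closest_assignment I V \<sigma>"
    using closest_assignment_exists k by fastforce
  define P where "P \<tau> = (SOME bs. bs \<in> bin_packings r (\<lambda>i. \<delta>_set I i V) (bound I) {i \<in> items I. \<sigma> i = \<tau>})" for \<tau>
  have "P \<tau> \<in> bin_packings r (\<lambda>i. \<delta>_set I i V) (bound I) {i \<in> items I. \<sigma> i = \<tau>}" for \<tau>
    unfolding P_def by (rule some_in_eq[THEN iffD2], rule bin_packings_nonempty) simp
  then show ?thesis using V \<sigma> unfolding decoupling_step_def by blast
qed

text \<open>Optimality of the chosen times allows a comparison with any \<open>W\<close> feasible
  for the same \<open>k\<close>, later the times of an optimal solution. The term
  \<open>real k * bound I\<close> collects one surplus bin per time.\<close>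

lemma decoupling_step_properties:
  assumes "valid_instance I" "S \<in> decoupling_step r I k" "k \<ge> 1"
  shows "feasible I S"
    and "ET_feasible I k W \<Longrightarrow>
      real (length S) * bound I \<le> 2 * (\<Sum>i\<in>items I. \<delta>_set I i W) + real k * bound I"
proof -
  obtain V \<sigma> P where S: "S = concat (map (\<lambda>\<tau>. map (\<lambda>A. (A, \<tau>)) (P \<tau>)) (sorted_list_of_set V))"
    and V: "ET_optimal I k V" and \<sigma>: "closest_assignment I V \<sigma>"
    and P: "\<And>\<tau>. \<tau> \<in> V \<Longrightarrow>
      P \<tau> \<in> bin_packings r (\<lambda>i. \<delta>_set I i V) (bound I) {i \<in> items I. \<sigma> i = \<tau>}"
    using assms(2) unfolding decoupling_step_def by blast
  define D where "D \<tau> = {i \<in> items I. \<sigma> i = \<tau>}" for \<tau>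
  have VF: "finite V" "card V = k" "\<forall>\<tau>\<in>V. \<tau> \<ge> 0" "\<forall>i\<in>items I. \<delta>_set I i V \<le> bound I"
    using V by (auto simp: ET_optimal_def is_arg_min_def ET_feasible_def)
  have \<sigma>V: "\<sigma> i \<in> V" "\<delta>_set I i V = \<delta> I i (\<sigma> i)" if "i \<in> items I" for i
    using \<sigma> \<delta>_set_argmin[OF VF(1)] that
    by (auto simp: closest_assignment_def is_arg_min_def)
  have B: "bound I \<ge> 0" using assms(1) by (simp add: valid_instance_def)
  \<comment> \<open>Feasibility for the subproblem says that each item fits into an empty
    bin.\<close>
  have sizes: "\<forall>i\<in>D \<tau>. 0 \<le> \<delta>_set I i V \<and> \<delta>_set I i V \<le> bound I" for \<tau>
    using VF(4) \<sigma>V by (auto simp: D_def)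
  note bp = bin_packings_properties[OF P[folded D_def] sizes B]
  let ?ts = "sorted_list_of_set V"
  have fst_S: "map fst S = concat (map P ?ts)"
    unfolding S by (simp add: map_concat comp_def)
  have dis: "sorted_wrt disjnt (map fst S)"
    unfolding fst_S
    by (rule disjnt_concat[where D = D]) (use VF bp in \<open>auto simp: D_def\<close>)
  have ne: "{} \<notin> set (map fst S)"
    unfolding fst_S using VF bp(2) by auto
  have "\<Union> (set (map fst S)) = (\<Union>\<tau>\<in>V. \<Union> (set (P \<tau>)))"
    unfolding fst_S using VF by auto
  also have "\<dots> = (\<Union>\<tau>\<in>V. D \<tau>)" using bp(1) by simp
  also have "\<dots> = items I" using \<sigma>V by (auto simp: D_def)
  finally have "partition_on (items I) (set (map fst S))"
    using disjnt_partition_on[OF dis ne] by simp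
  moreover have "\<mu> \<ge> 0 \<and> (\<Sum>i\<in>A. \<delta> I i \<mu>) \<le> bound I" if "(A, \<mu>) \<in> set S" for A \<mu>
  proof -
    have A: "\<mu> \<in> V" "A \<in> set (P \<mu>)" using that VF by (auto simp: S)
    then have "A \<subseteq> D \<mu>" using bp(1) by blast
    \<comment> \<open>Items are delivered at a closest time, so packed size and actual deviation
      agree and the capacity becomes the inventory bound.\<close>
    then have "(\<Sum>i\<in>A. \<delta> I i \<mu>) = (\<Sum>i\<in>A. \<delta>_set I i V)"
      using \<sigma>V by (intro sum.cong) (auto simp: D_def)
    then show ?thesis using bp(4) A VF by auto
  qed
  ultimately show "feasible I S"
    using disjnt_distinct[OF dis ne] by (auto simp: feasible_def)
  assume "ET_feasible I k W"
  then have opt: "(\<Sum>i\<in>items I. \<delta>_set I i V) \<le> (\<Sum>i\<in>items I. \<delta>_set I i W)"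
    using V by (auto simp: ET_optimal_def is_arg_min_linorder)
  have "length S = (\<Sum>\<tau>\<in>V. length (P \<tau>))"
    unfolding S using VF by (simp add: length_concat comp_def sum_list_distinct_conv_sum_set)
  then have "real (length S) * bound I = (\<Sum>\<tau>\<in>V. real (length (P \<tau>)) * bound I)"
    by (simp add: sum_distrib_right)
  also have "\<dots> \<le> (\<Sum>\<tau>\<in>V. 2 * (\<Sum>i\<in>D \<tau>. \<delta>_set I i V) + bound I)"
    by (intro sum_mono bp(5))
  also have "\<dots> = 2 * (\<Sum>\<tau>\<in>V. \<Sum>i\<in>D \<tau>. \<delta>_set I i V) + real k * bound I"
    using VF by (simp add: sum.distrib sum_distrib_left)
  also have "(\<Sum>\<tau>\<in>V. \<Sum>i\<in>D \<tau>. \<delta>_set I i V) = (\<Sum>i\<in>items I. \<delta>_set I i V)"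
    unfolding D_def by (rule sum.group) (use VF \<sigma>V in auto)
  finally show "real (length S) * bound I \<le> 2 * (\<Sum>i\<in>items I. \<delta>_set I i W) + real k * bound I"
    using opt by linarith
qed

theorem theorem15:
  fixes r :: packing_rule
  shows "asymptotically_approximate 3 (decoupling r)"
  unfolding asymptotically_approximate_def
\<comment> \<open>The additive constant is 0: the surplus bins, one per time, are charged to the
  bins of an optimal solution.\<close>
proof (intro exI[of _ 0] allI impI conjI ballI)
  fix I assume I: "valid_instance I"
  obtain S\<^sub>0 where S\<^sub>0: "feasible I S\<^sub>0" "length S\<^sub>0 = opt_bins I" "opt_bins I \<le> num_items I"
    using optimal_solution[OF I] .
  \<comment> \<open>\<open>k\<^sub>0\<close> counts the distinct delivery times of an optimal
    solution. It is among the values tried, so the output is no longer than the solution found for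
    \<open>k\<^sub>0\<close>.\<close>
  define W k\<^sub>0 where "W = snd ` set S\<^sub>0" and "k\<^sub>0 = card W"
  note W = feasible_ET[OF I S\<^sub>0(1), folded W_def, folded k\<^sub>0_def]
  have k\<^sub>0: "k\<^sub>0 \<in> feasible_ks I"
    using W S\<^sub>0 by (auto simp: feasible_ks_def)
  have "\<forall>k\<in>feasible_ks I. \<exists>S. S \<in> decoupling_step r I k"
    using decoupling_step_nonempty[OF I] by blast
  then obtain T where "\<forall>k\<in>feasible_ks I. T k \<in> decoupling_step r I k" by metis
  moreover have "finite (feasible_ks I)" by (simp add: feasible_ks_def)
  then obtain k where "is_arg_min (\<lambda>k. length (T k)) (\<lambda>k. k \<in> feasible_ks I) k"
    using ex_is_arg_min_if_finite k\<^sub>0 by blast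
  ultimately show "decoupling r I \<noteq> {}" unfolding decoupling_def by blast
  fix S assume "S \<in> decoupling r I"
  then obtain T k where T: "\<And>k. k \<in> feasible_ks I \<Longrightarrow> T k \<in> decoupling_step r I k"
    and k: "is_arg_min (\<lambda>k. length (T k)) (\<lambda>k. k \<in> feasible_ks I) k" and S: "S = T k"
    unfolding decoupling_def by blast
  have kf: "k \<in> feasible_ks I" and le: "length S \<le> length (T k\<^sub>0)"
    using k k\<^sub>0 S by (auto simp: is_arg_min_linorder)
  then have "k \<ge> 1" by (simp add: feasible_ks_def)
  then show "feasible I S"
    using decoupling_step_properties(1)[OF I T[OF kf]] S by simp
  have B: "bound I > 0" using I by (simp add: valid_instance_def)
  have "real (length S) * bound I \<le> real (length (T k\<^sub>0)) * bound I"
    using le B by simp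
  also have "\<dots> \<le> 2 * (\<Sum>i\<in>items I. \<delta>_set I i W) + real k\<^sub>0 * bound I"
    by (rule decoupling_step_properties(2)[OF I T[OF k\<^sub>0] W(2,1)])
  also have "\<dots> \<le> 2 * (real (opt_bins I) * bound I) + real (opt_bins I) * bound I"
    using W(3,4) S\<^sub>0(2) B by (intro add_mono mult_left_mono mult_right_mono) auto
  finally have "real (length S) * bound I \<le> (3 * real (opt_bins I)) * bound I"
    by (simp add: algebra_simps)
  then show "real (length S) \<le> 3 * real (opt_bins I) + 0"
    using B by simp
qed

end
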